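(* Suppose that $0<\tau<\frac{1+\sqrt5}{2}$ and $\beta>\bar\beta$, where $$\bar\beta=\max\left\{\max\{1/\tau,\tau\}\cdot\lambda_{\max},\ -\frac{\lambda_{\min}}{2}+\frac12\sqrt{\lambda_{\min}^2+\max\left\{\frac1\tau,\frac{\tau^2}{1+\tau-\tau^2}\right\}\cdot8\lambda_{\max}^2}\right\}.$$ Let $\{(L^k,S^k,Z^k,\Lambda^k)\}_{k=1}^\infty$ be a sequence generated by the ADMM described in the context. Suppose that (a1) $\mathcal{B}^*\mathcal{B}\succeq\sigma\mathcal{I}$ for some $\sigma>0$ and $\mathcal{C}^*\mathcal{C}\succeq\sigma'\mathcal{I}$ for some $\sigma'>0$; and (a3) the first iterate satisfies $\Theta_{\tau,\beta}(L^1,S^1,Z^1,\Lambda^1)<h_0:=\liminf_{\|L\|_F+\|S\|_F\to\infty}\Psi(L)+\Phi(S)$. Then the sequence $\{(L^k,S^k,Z^k,\Lambda^k)\}_{k=1}^\infty$ is bounded.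
   Context: Setting. $\mathbb{R}^{m\times n}$ carries the trace inner product $\langle X,Y\rangle=\sum_{i,j}x_{ij}y_{ij}$ and Frobenius norm $\|\cdot\|_F$. $D\in\mathbb{R}^{m\times n}$ is given. $\Psi,\Phi:\mathbb{R}^{m\times n}\to\mathbb{R}_+\cup\{\infty\}$ are proper closed (lower semicontinuous) nonnegative functions, $\Psi$ is convex, $\Phi$ is possibly nonconvex and nonsmooth. $\mathcal{A},\mathcal{B},\mathcal{C}:\mathbb{R}^{m\times n}\to\mathbb{R}^{m\times n}$ are linear maps with $\mathcal{B},\mathcal{C}$ injective; $^*$ denotes the adjoint, $\mathcal{I}$ the identity map. $\lambda_{\max}$ and $\lambda_{\min}$ are the largest and smallest eigenvalues of $\mathcal{A}^*\mathcal{A}$. The problem is $\min_{L,S}\Psi(L)+\Phi(S)+\frac12\|D-\mathcal{A}[\mathcal{B}(L)+\mathcal{C}(S)]\|_F^2$. Its augmented Lagrangian (after introducing $Z=\mathcal{B}(L)+\mathcal{C}(S)$), with penalty parameter $\beta>0$, is $$\mathcal{L}_\beta(L,S,Z,\Lambda)=\Psi(L)+\Phi(S)+\tfrac12\|D-\mathcal{A}(Z)\|_F^2-\langle\Lambda,\mathcal{B}(L)+\mathcal{C}(S)-Z\rangle+\tfrac\beta2\|\mathcal{B}(L)+\mathcal{C}(S)-Z\|_F^2 .$$ ADMM. Given an initial point $(S^0,Z^0,\Lambda^0)$, dual step-size $\tau>0$ and $\beta>0$, for $k=0,1,2,\dots$ a sequence generated by the ADMM satisfies $L^{k+1}\in\operatorname{Argmin}_L\mathcal{L}_\beta(L,S^k,Z^k,\Lambda^k)$;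 $S^{k+1}\in\operatorname{Argmin}_S\mathcal{L}_\beta(L^{k+1},S,Z^k,\Lambda^k)$; $Z^{k+1}=\operatorname{argmin}_Z\mathcal{L}_\beta(L^{k+1},S^{k+1},Z,\Lambda^k)$; $\Lambda^{k+1}=\Lambda^k-\tau\beta(\mathcal{B}(L^{k+1})+\mathcal{C}(S^{k+1})-Z^{k+1})$. Potential function. For $0<\tau<\frac{1+\sqrt5}{2}$, let $\theta(\tau)=\max\left\{1-\tau,\frac{(\tau-1)\tau^2}{1+\tau-\tau^2}\right\}$ and $$\Theta_{\tau,\beta}(L,S,Z,\Lambda)=\mathcal{L}_\beta(L,S,Z,\Lambda)+\theta(\tau)\beta\|\mathcal{B}(L)+\mathcal{C}(S)-Z\|_F^2 .$$ *)

theory Defs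
  imports "HOL-Analysis.Analysis"
begin

text \<open>
  The space of real \<open>m \<times> n\<close> matrices is \<open>real^'n^'m\<close>. Its library inner product is
  \<open>\<Sum>i j. X$i$j * Y$i$j\<close>, the trace inner product, so its library norm is the Frobenius norm.
\<close>

section \<open>Extended-real-valued functions\<close>

definition proper_fun :: "('a \<Rightarrow> ereal) \<Rightarrow> bool" where
  "proper_fun f \<longleftrightarrow> (\<forall>x. f x \<noteq> -\<infinity>) \<and> (\<exists>x. f x \<noteq> \<infinity>)"

definition lower_semicontinuous :: "('a::topological_space \<Rightarrow> ereal) \<Rightarrow> bool" where
  "lower_semicontinuous f \<longleftrightarrow> (\<forall>x. f x \<le> Liminf (at x) f)"

text \<open>Intended for functions that do not take the value \<open>-\<infinity>\<close>, so that the right-hand side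
  never has the form \<open>\<infinity> - \<infinity>\<close>.\<close>

definition ereal_convex :: "('a::real_vector \<Rightarrow> ereal) \<Rightarrow> bool" where
  "ereal_convex f \<longleftrightarrow>
     (\<forall>x y. \<forall>u>0. \<forall>v>0. u + v = 1 \<longrightarrow>
        f (u *\<^sub>R x + v *\<^sub>R y) \<le> ereal u * f x + ereal v * f y)"

section \<open>Linear operators\<close>

definition eigenvalues :: "('a::real_vector \<Rightarrow> 'a) \<Rightarrow> real set" where
  "eigenvalues T = {l. \<exists>v. v \<noteq> 0 \<and> T v = l *\<^sub>R v}"

definition eig_max :: "('a::real_vector \<Rightarrow> 'a) \<Rightarrow> real" where
  "eig_max T = Max (eigenvalues T)"

definition eig_min :: "('a::real_vector \<Rightarrow> 'a) \<Rightarrow> real" where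
  "eig_min T = Min (eigenvalues T)"

definition psd :: "('a::euclidean_space \<Rightarrow> 'a) \<Rightarrow> bool" where
  "psd T \<longleftrightarrow> linear T \<and> adjoint T = T \<and> (\<forall>x. 0 \<le> T x \<bullet> x)"

text \<open>The order \<open>T \<succeq> U\<close> on self-adjoint operators.\<close>

definition loewner_ge :: "('a::euclidean_space \<Rightarrow> 'a) \<Rightarrow> ('a \<Rightarrow> 'a) \<Rightarrow> bool" where
  "loewner_ge T U \<longleftrightarrow> psd (\<lambda>x. T x - U x)"

section \<open>Augmented Lagrangian, ADMM and potential function\<close>

definition aug_lagrangian ::
  "('a::euclidean_space \<Rightarrow> ereal) \<Rightarrow> ('a \<Rightarrow> ereal) \<Rightarrow> ('a \<Rightarrow> 'a) \<Rightarrow> ('a \<Rightarrow> 'a) \<Rightarrow> ('a \<Rightarrow> 'a) \<Rightarrow> 'a \<Rightarrow> real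
    \<Rightarrow> 'a \<Rightarrow> 'a \<Rightarrow> 'a \<Rightarrow> 'a \<Rightarrow> ereal" where
  "aug_lagrangian \<Psi> \<Phi> A B C D \<beta> L S Z \<Lambda> =
     \<Psi> L + \<Phi> S + ereal (1/2 * (norm (D - A Z))\<^sup>2
       - \<Lambda> \<bullet> (B L + C S - Z) + \<beta>/2 * (norm (B L + C S - Z))\<^sup>2)"

text \<open>\<open>L 0\<close> is unconstrained: the initial point is \<open>(S 0, Z 0, \<Lambda> 0)\<close>. The \<open>Z\<close>-objective, where
  finite, is strictly convex, so being a minimiser in the third clause determines \<open>Z (Suc k)\<close>.\<close>

definition admm_sequence ::
  "('a::euclidean_space \<Rightarrow> ereal) \<Rightarrow> ('a \<Rightarrow> ereal) \<Rightarrow> ('a \<Rightarrow> 'a) \<Rightarrow> ('a \<Rightarrow> 'a) \<Rightarrow> ('a \<Rightarrow> 'a) \<Rightarrow> 'a \<Rightarrow> real \<Rightarrow> real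
    \<Rightarrow> (nat \<Rightarrow> 'a) \<Rightarrow> (nat \<Rightarrow> 'a) \<Rightarrow> (nat \<Rightarrow> 'a) \<Rightarrow> (nat \<Rightarrow> 'a) \<Rightarrow> bool" where
  "admm_sequence \<Psi> \<Phi> A B C D \<tau> \<beta> L S Z \<Lambda> \<longleftrightarrow>
     (\<forall>k.
       is_arg_min (\<lambda>X. aug_lagrangian \<Psi> \<Phi> A B C D \<beta> X (S k) (Z k) (\<Lambda> k))
         (\<lambda>_. True) (L (Suc k)) \<and>
       is_arg_min (\<lambda>X. aug_lagrangian \<Psi> \<Phi> A B C D \<beta> (L (Suc k)) X (Z k) (\<Lambda> k))
         (\<lambda>_. True) (S (Suc k)) \<and>
       is_arg_min (\<lambda>X. aug_lagrangian \<Psi> \<Phi> A B C D \<beta> (L (Suc k)) (S (Suc k)) X (\<Lambda> k))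
         (\<lambda>_. True) (Z (Suc k)) \<and>
       \<Lambda> (Suc k) = \<Lambda> k - (\<tau> * \<beta>) *\<^sub>R (B (L (Suc k)) + C (S (Suc k)) - Z (Suc k)))"

definition theta :: "real \<Rightarrow> real" where
  "theta \<tau> = max (1 - \<tau>) ((\<tau> - 1) * \<tau>\<^sup>2 / (1 + \<tau> - \<tau>\<^sup>2))"

definition potential ::
  "('a::euclidean_space \<Rightarrow> ereal) \<Rightarrow> ('a \<Rightarrow> ereal) \<Rightarrow> ('a \<Rightarrow> 'a) \<Rightarrow> ('a \<Rightarrow> 'a) \<Rightarrow> ('a \<Rightarrow> 'a) \<Rightarrow> 'a \<Rightarrow> real \<Rightarrow> real
    \<Rightarrow> 'a \<Rightarrow> 'a \<Rightarrow> 'a \<Rightarrow> 'a \<Rightarrow> ereal" where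
  "potential \<Psi> \<Phi> A B C D \<tau> \<beta> L S Z \<Lambda> =
     aug_lagrangian \<Psi> \<Phi> A B C D \<beta> L S Z \<Lambda>
       + ereal (theta \<tau> * \<beta> * (norm (B L + C S - Z))\<^sup>2)"

definition beta_bar :: "real \<Rightarrow> real \<Rightarrow> real \<Rightarrow> real" where
  "beta_bar \<tau> lmax lmin =
     max (max (1/\<tau>) \<tau> * lmax)
         (- lmin/2 + 1/2 * sqrt (lmin\<^sup>2 + max (1/\<tau>) (\<tau>\<^sup>2 / (1 + \<tau> - \<tau>\<^sup>2)) * 8 * lmax\<^sup>2))"

definition liminf_at_infinity ::
  "('a::real_normed_vector \<Rightarrow> ereal) \<Rightarrow> ('a \<Rightarrow> ereal) \<Rightarrow> ereal" where
  "liminf_at_infinity \<Psi> \<Phi> =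
     Liminf (filtercomap (\<lambda>(L, S). norm L + norm S) at_top) (\<lambda>(L, S). \<Psi> L + \<Phi> S)"

end

theory Submission
  imports Defs
begin

text \<open>
  Let \<open>W\<^sup>k = B L\<^sup>k + C S\<^sup>k - Z\<^sup>k\<close>. The optimality condition of the \<open>Z\<close>-step turns the multiplier
  update into \<open>\<Lambda>\<^sup>k = A\<^sup>* (D - A Z\<^sup>k) + (1 - \<tau>) \<beta> W\<^sup>k\<close> for \<open>k \<ge> 1\<close>. Subtracting two consecutive
  instances gives \<open>W\<^sup>k\<^sup>+\<^sup>1 = (1 - \<tau>) W\<^sup>k + \<beta>\<^sup>-\<^sup>1 A\<^sup>* A (Z\<^sup>k\<^sup>+\<^sup>1 - Z\<^sup>k)\<close>; convexity of the squared norm then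
  bounds the increase of the potential in the dual step by a multiple of \<open>\<parallel>Z\<^sup>k\<^sup>+\<^sup>1 - Z\<^sup>k\<parallel>\<^sup>2\<close>, which is
  absorbed by the strong convexity of the \<open>Z\<close>-step because \<open>\<beta>\<close> exceeds its threshold. Hence the
  potential is nonincreasing. Completing the square with the formula for \<open>\<Lambda>\<^sup>k\<close> shows that it
  dominates \<open>\<Psi> L\<^sup>k + \<Phi> S\<^sup>k + (\<beta> - \<lambda>\<^sub>m\<^sub>a\<^sub>x)/2 \<parallel>W\<^sup>k\<parallel>\<^sup>2\<close>. Its initial value being below \<open>h\<^sub>0\<close>, the iterates
  \<open>L\<^sup>k, S\<^sup>k\<close> and \<open>W\<^sup>k\<close> are bounded, and so are \<open>Z\<^sup>k\<close> and \<open>\<Lambda>\<^sup>k\<close>.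
\<close>

section \<open>Rayleigh quotients of self-adjoint operators\<close>

text \<open>The linear term dominates near \<open>t = 0\<close>, so a nonzero \<open>a\<close> would
  produce a negative value. This is the first-order condition behind both variational arguments
  below.\<close>

lemma linear_coeff_eq_0_of_quadratic_nonneg:
  fixes a b :: real
  assumes nonneg: "\<And>t. 0 \<le> a * t + b * t\<^sup>2"
  shows "a = 0"
proof (rule ccontr)
  assume "a \<noteq> 0"
  \<comment> \<open>Any positive \<open>c > b\<close> would do: it makes the quadratic negative at
    \<open>t = - a / c\<close>.\<close>
  define c where "c = \<bar>b\<bar> + 1"
  have "c > 0" "b < c" unfolding c_def by auto
  have "0 \<le> a * (- a / c) + b * (- a / c)\<^sup>2" by (rule nonneg)
  also have "\<dots> = a\<^sup>2 * (b - c) / c\<^sup>2"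
    using \<open>c > 0\<close> by (simp add: field_simps power2_eq_square)
  also have "\<dots> < 0"
    using \<open>a \<noteq> 0\<close> \<open>b < c\<close> \<open>c > 0\<close> by (intro divide_neg_pos mult_pos_neg) auto
  finally show False by simp
qed

text \<open>Eigenvectors for distinct eigenvalues are orthogonal, hence linearly independent.
  Finiteness is what lets \<open>Max\<close> and \<open>Min\<close> bound every eigenvalue.\<close>

lemma finite_eigenvalues_selfadjoint:
  fixes T :: "'a::euclidean_space \<Rightarrow> 'a"
  assumes sym: "\<And>x y. T x \<bullet> y = x \<bullet> T y"
  shows "finite (eigenvalues T)"
proof -
  have "\<forall>l\<in>eigenvalues T. \<exists>v. v \<noteq> 0 \<and> T v = l *\<^sub>R v" unfolding eigenvalues_def by blast
  then obtain v where v: "\<And>l. l \<in> eigenvalues T \<Longrightarrow> v l \<noteq> 0 \<and> T (v l) = l *\<^sub>R v l"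
    by metis
  have orth: "v k \<bullet> v l = 0" if "k \<in> eigenvalues T" "l \<in> eigenvalues T" "k \<noteq> l" for k l
    using sym[of "v k" "v l"] v[OF that(1)] v[OF that(2)] that(3) by simp
  have inj: "inj_on v (eigenvalues T)"
    using orth v by (metis inj_onI inner_eq_zero_iff)
  have "pairwise orthogonal (v ` eigenvalues T)"
    unfolding pairwise_def orthogonal_def using orth by blast
  moreover have "0 \<notin> v ` eigenvalues T" using v by auto
  ultimately have "finite (v ` eigenvalues T)"
    using pairwise_orthogonal_independent independent_imp_finite by blast
  then show ?thesis using inj by (rule finite_imageD)
qed

text \<open>The quadratic form attains its maximum on the compact unit sphere, and stationarity
  makes a maximiser an eigenvector.\<close>

lemma selfadjoint_max_eigenvalue:
  fixes T :: "'a::euclidean_space \<Rightarrow> 'a"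
  assumes lin: "linear T" and sym: "\<And>x y. T x \<bullet> y = x \<bullet> T y"
  shows "\<exists>l\<in>eigenvalues T. \<forall>x. T x \<bullet> x \<le> l * (norm x)\<^sup>2"
proof -
  have "continuous_on (sphere 0 1) (\<lambda>x. T x \<bullet> x)"
    using lin by (intro continuous_intros linear_continuous_on linear_conv_bounded_linear[THEN iffD1])
  moreover obtain b :: 'a where "b \<in> Basis" using nonempty_Basis by blast
  then have "b \<in> sphere 0 1" by simp
  ultimately obtain u where u: "norm u = 1" and max: "\<And>x. norm x = 1 \<Longrightarrow> T x \<bullet> x \<le> T u \<bullet> u"
    using continuous_attains_sup[of "sphere (0::'a) 1" "\<lambda>x. T x \<bullet> x"] by fastforce
  define l where "l = T u \<bullet> u"
  have le: "T x \<bullet> x \<le> l * (norm x)\<^sup>2" for x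
  proof (cases "x = 0")
    case False
    define y where "y = (1 / norm x) *\<^sub>R x"
    have x: "x = norm x *\<^sub>R y" using False by (simp add: y_def)
    have "norm y = 1" using False by (simp add: y_def)
    then have "T y \<bullet> y \<le> l" using max l_def by simp
    moreover have "T x \<bullet> x = (norm x)\<^sup>2 * (T y \<bullet> y)"
      by (subst (1 2) x) (simp add: linear_scale[OF lin] power2_eq_square)
    ultimately show ?thesis by (metis mult.commute mult_right_mono zero_le_power2)
  qed (use lin linear_0 in simp)
  \<comment> \<open>The form \<open>l * (norm x)\<^sup>2 - T x \<bullet> x\<close> is nonnegative
    and vanishes at \<open>u\<close>, so its derivative at \<open>u\<close> in every direction
    \<open>h\<close> is zero.\<close>
  have "(l *\<^sub>R u - T u) \<bullet> h = 0" for h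
  proof -
    have "0 \<le> 2 * ((l *\<^sub>R u - T u) \<bullet> h) * t + (l * (norm h)\<^sup>2 - T h \<bullet> h) * t\<^sup>2" for t
    proof -
      have "0 \<le> l * (norm (u + t *\<^sub>R h))\<^sup>2 - T (u + t *\<^sub>R h) \<bullet> (u + t *\<^sub>R h)"
        using le by simp
      also have "\<dots> = l * (norm u)\<^sup>2 - T u \<bullet> u
          + 2 * ((l *\<^sub>R u - T u) \<bullet> h) * t + (l * (norm h)\<^sup>2 - T h \<bullet> h) * t\<^sup>2"
        using sym[of h u]
        unfolding power2_norm_eq_inner
        by (simp add: linear_add[OF lin] linear_scale[OF lin] inner_simps inner_commute
            power2_eq_square algebra_simps del: dot_square_norm)
      finally show ?thesis using u l_def by simp
    qed
    then show ?thesis using linear_coeff_eq_0_of_quadratic_nonneg by fastforce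
  qed
  then have "T u = l *\<^sub>R u" by (metis eq_iff_diff_eq_0 inner_eq_zero_iff)
  moreover have "u \<noteq> 0" using u by auto
  ultimately have "l \<in> eigenvalues T" unfolding eigenvalues_def by blast
  then show ?thesis using le by blast
qed

lemma inner_le_eig_max:
  fixes T :: "'a::euclidean_space \<Rightarrow> 'a"
  assumes "linear T" and "\<And>x y. T x \<bullet> y = x \<bullet> T y"
  shows "T x \<bullet> x \<le> eig_max T * (norm x)\<^sup>2"
proof -
  obtain l where "l \<in> eigenvalues T" and l: "T x \<bullet> x \<le> l * (norm x)\<^sup>2"
    using selfadjoint_max_eigenvalue[OF assms] by blast
  then have "l \<le> eig_max T"
    unfolding eig_max_def using finite_eigenvalues_selfadjoint assms(2) by (metis Max_ge)
  then show ?thesis using l by (meson mult_right_mono order_trans zero_le_power2)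
qed

text \<open>The maximum result applies to \<open>- T\<close>, whose eigenvalues are the negatives of
  those of \<open>T\<close>.\<close>

lemma eig_min_le_inner:
  fixes T :: "'a::euclidean_space \<Rightarrow> 'a"
  assumes "linear T" and sym: "\<And>x y. T x \<bullet> y = x \<bullet> T y"
  shows "eig_min T * (norm x)\<^sup>2 \<le> T x \<bullet> x"
proof -
  obtain l where "l \<in> eigenvalues (\<lambda>x. - T x)" and l: "- T x \<bullet> x \<le> l * (norm x)\<^sup>2"
    using selfadjoint_max_eigenvalue[of "\<lambda>x. - T x"] assms by (auto simp: linear_compose_neg)
  then obtain v where "v \<noteq> 0" and "- T v = l *\<^sub>R v" unfolding eigenvalues_def by blast
  then have "T v = - l *\<^sub>R v" by (metis minus_minus scaleR_minus_left)
  then have "- l \<in> eigenvalues T" unfolding eigenvalues_def using \<open>v \<noteq> 0\<close> by blast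
  then have "eig_min T \<le> - l"
    unfolding eig_min_def using finite_eigenvalues_selfadjoint sym by (metis Min_le)
  then have "eig_min T * (norm x)\<^sup>2 \<le> - l * (norm x)\<^sup>2" by (intro mult_right_mono) auto
  then show ?thesis using l by simp
qed

section \<open>Spectral bounds for the Gram operator of \<open>A\<close>\<close>

lemma gram_operator:
  fixes A :: "'a::euclidean_space \<Rightarrow> 'a"
  assumes "linear A"
  shows "linear (adjoint A \<circ> A)" "(adjoint A \<circ> A) x \<bullet> y = x \<bullet> (adjoint A \<circ> A) y"
    "(adjoint A \<circ> A) x \<bullet> x = (norm (A x))\<^sup>2"
  using assms adjoint_linear[OF assms]
  by (auto intro: linear_compose simp: adjoint_works adjoint_clauses power2_norm_eq_inner)

lemma norm_sq_le_eig_max: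
  fixes A :: "'a::euclidean_space \<Rightarrow> 'a"
  assumes "linear A"
  shows "(norm (A x))\<^sup>2 \<le> eig_max (adjoint A \<circ> A) * (norm x)\<^sup>2"
  using inner_le_eig_max[OF gram_operator(1,2)[OF assms]] gram_operator(3)[OF assms] by metis

lemma eig_min_le_norm_sq:
  fixes A :: "'a::euclidean_space \<Rightarrow> 'a"
  assumes "linear A"
  shows "eig_min (adjoint A \<circ> A) * (norm x)\<^sup>2 \<le> (norm (A x))\<^sup>2"
  using eig_min_le_inner[OF gram_operator(1,2)[OF assms]] gram_operator(3)[OF assms] by metis

lemma eig_max_gram_nonneg:
  fixes A :: "'a::euclidean_space \<Rightarrow> 'a"
  assumes "linear A"
  shows "0 \<le> eig_max (adjoint A \<circ> A)"
proof -
  obtain b :: 'a where "b \<in> Basis" using nonempty_Basis by blast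
  then have "(norm (A b))\<^sup>2 \<le> eig_max (adjoint A \<circ> A)"
    using norm_sq_le_eig_max[OF assms, of b] by simp
  then show ?thesis by (meson order_trans zero_le_power2)
qed

text \<open>With \<open>g\<close> for \<open>adjoint A (A x)\<close>,
  \<open>(norm g)\<^sup>2\<close> equals \<open>A x \<bullet> A g\<close>; each factor costs the
  square root of the largest eigenvalue, and one \<open>norm g\<close> cancels.\<close>

lemma norm_gram_le_eig_max:
  fixes A :: "'a::euclidean_space \<Rightarrow> 'a"
  assumes "linear A"
  shows "(norm (adjoint A (A x)))\<^sup>2 \<le> (eig_max (adjoint A \<circ> A))\<^sup>2 * (norm x)\<^sup>2"
proof -
  let ?l = "eig_max (adjoint A \<circ> A)" and ?g = "adjoint A (A x)"
  have le: "norm (A y) \<le> sqrt ?l * norm y" for y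
    using norm_sq_le_eig_max[OF assms, of y] eig_max_gram_nonneg[OF assms]
    by (metis norm_ge_zero real_le_rsqrt real_sqrt_mult real_sqrt_abs abs_norm_cancel)
  have "norm ?g * norm ?g = A x \<bullet> A ?g"
    using adjoint_works[OF assms, of "?g" "A x"]
    by (simp add: inner_commute flip: power2_norm_eq_inner power2_eq_square)
  also have "\<dots> \<le> norm (A x) * norm (A ?g)" by (rule norm_cauchy_schwarz)
  also have "\<dots> \<le> (sqrt ?l * norm x) * (sqrt ?l * norm ?g)"
    by (intro mult_mono le) (auto simp: eig_max_gram_nonneg[OF assms])
  also have "\<dots> = ?l * norm x * norm ?g"
    using eig_max_gram_nonneg[OF assms] by simp
  finally have "norm ?g \<le> ?l * norm x"
    using eig_max_gram_nonneg[OF assms] by (cases "norm ?g = 0") auto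
  then have "(norm ?g)\<^sup>2 \<le> (?l * norm x)\<^sup>2" by (intro power_mono) auto
  then show ?thesis by (simp add: power_mult_distrib)
qed

section \<open>Step-size inequalities\<close>

text \<open>The quadratic has the roots \<open>(1 + sqrt 5) / 2\<close> and
  \<open>(1 - sqrt 5) / 2\<close>, and \<tau> lies strictly between them.\<close>

lemma golden_ratio_pos:
  fixes \<tau> :: real
  assumes "0 < \<tau>" and "\<tau> < (1 + sqrt 5) / 2"
  shows "0 < 1 + \<tau> - \<tau>\<^sup>2"
proof -
  have "sqrt 5 > 1" by simp
  then have "0 < ((1 + sqrt 5) / 2 - \<tau>) * (\<tau> + (sqrt 5 - 1) / 2)"
    using assms by (intro mult_pos_pos add_pos_pos) auto
  also have "\<dots> = 1 + \<tau> - \<tau>\<^sup>2"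
    by (simp add: field_simps power2_eq_square)
  finally show ?thesis .
qed

lemma norm_sq_convex_comb_le:
  fixes a b :: "'a::real_inner"
  assumes "0 \<le> s" and "s \<le> 1"
  shows "(norm (s *\<^sub>R a + (1 - s) *\<^sub>R b))\<^sup>2 \<le> s * (norm a)\<^sup>2 + (1 - s) * (norm b)\<^sup>2"
proof -
  have "s * (norm a)\<^sup>2 + (1 - s) * (norm b)\<^sup>2 - (norm (s *\<^sub>R a + (1 - s) *\<^sub>R b))\<^sup>2
      = s * (1 - s) * (norm (a - b))\<^sup>2"
    by (simp add: power2_norm_eq_inner inner_simps inner_commute algebra_simps)
  then show ?thesis
    using assms by (smt (verit) mult_nonneg_nonneg zero_le_power2)
qed

text \<open>In the application \<open>w\<close> is the old residual and the combination of
  \<open>w\<close> and \<open>g\<close> is the new one. With the weight \<open>theta \<tau>\<close>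
  the terms in \<open>(norm w)\<^sup>2\<close> cancel after convexity is applied.\<close>

lemma residual_recursion_bound:
  fixes w g :: "'a::real_inner"
  assumes tau: "0 < \<tau>" "\<tau> < (1 + sqrt 5) / 2" and beta: "0 < \<beta>"
  shows "(\<tau> + theta \<tau>) * \<beta> * (norm ((1 - \<tau>) *\<^sub>R w + (1 / \<beta>) *\<^sub>R g))\<^sup>2 - theta \<tau> * \<beta> * (norm w)\<^sup>2
    \<le> max (1 / \<tau>) (\<tau>\<^sup>2 / (1 + \<tau> - \<tau>\<^sup>2)) / \<beta> * (norm g)\<^sup>2"
    (is "?lhs \<le> ?K / \<beta> * _")
proof (cases "\<tau> \<le> 1")
  case True
  have "(\<tau> - 1) * \<tau>\<^sup>2 / (1 + \<tau> - \<tau>\<^sup>2) \<le> 0"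
    using True golden_ratio_pos[OF tau] by (intro divide_nonpos_pos mult_nonpos_nonneg) auto
  then have th: "theta \<tau> = 1 - \<tau>" unfolding theta_def using True by auto
  \<comment> \<open>The convex weights are \<open>1 - \<tau>\<close> and \<open>\<tau>\<close>, so
    \<open>g\<close> is rescaled by \<open>1 / (\<tau> * \<beta>)\<close>; here
    \<open>\<tau> + theta \<tau> = 1\<close>.\<close>
  have "(norm ((1 - \<tau>) *\<^sub>R w + (1 / \<beta>) *\<^sub>R g))\<^sup>2 \<le> (1 - \<tau>) * (norm w)\<^sup>2 + \<tau> * (norm ((1 / (\<tau> * \<beta>)) *\<^sub>R g))\<^sup>2"
    using norm_sq_convex_comb_le[of "1 - \<tau>" w "(1 / (\<tau> * \<beta>)) *\<^sub>R g"] True tau by simp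
  also have "\<dots> = (1 - \<tau>) * (norm w)\<^sup>2 + (norm g)\<^sup>2 / (\<tau> * \<beta>\<^sup>2)"
    using tau beta by (simp add: power_mult_distrib power_divide power2_eq_square)
  finally have "\<beta> * (norm ((1 - \<tau>) *\<^sub>R w + (1 / \<beta>) *\<^sub>R g))\<^sup>2
      \<le> \<beta> * ((1 - \<tau>) * (norm w)\<^sup>2 + (norm g)\<^sup>2 / (\<tau> * \<beta>\<^sup>2))"
    using beta by (intro mult_left_mono) auto
  then have "?lhs \<le> (1 / \<tau>) / \<beta> * (norm g)\<^sup>2"
    using tau beta by (simp add: th algebra_simps power2_eq_square)
  also have "\<dots> \<le> ?K / \<beta> * (norm g)\<^sup>2"
    using beta by (intro mult_right_mono divide_right_mono) auto
  finally show ?thesis .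
next
  case False
  define d where "d = 1 + \<tau> - \<tau>\<^sup>2"
  have d: "d > 0" unfolding d_def by (rule golden_ratio_pos[OF tau])
  have th: "theta \<tau> = (\<tau> - 1) * \<tau>\<^sup>2 / d"
  proof -
    have "0 \<le> (\<tau> - 1) * \<tau>\<^sup>2 / d" using False d by simp
    then show ?thesis unfolding theta_def d_def[symmetric] using False by auto
  qed
  have sum: "\<tau> + theta \<tau> = \<tau> / d"
    unfolding th using d by (simp add: field_simps) (simp add: d_def power2_eq_square algebra_simps)
  \<comment> \<open>Now \<open>1 - \<tau>\<close> is negative and cannot be a weight. Moving the
    factor \<open>- \<tau>\<close> into the vector leaves the weights
    \<open>(\<tau> - 1) / \<tau>\<close> and \<open>1 / \<tau>\<close>.\<close>
  have "(1 - \<tau>) *\<^sub>R w + (1 / \<beta>) *\<^sub>R g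
      = ((\<tau> - 1) / \<tau>) *\<^sub>R ((- \<tau>) *\<^sub>R w) + (1 - (\<tau> - 1) / \<tau>) *\<^sub>R ((\<tau> / \<beta>) *\<^sub>R g)"
  proof -
    have "(\<tau> - 1) / \<tau> * (- \<tau>) = 1 - \<tau>" and "(1 - (\<tau> - 1) / \<tau>) * (\<tau> / \<beta>) = 1 / \<beta>"
      using tau beta by (auto simp: field_simps)
    then show ?thesis by (simp only: scaleR_scaleR)
  qed
  then have "(norm ((1 - \<tau>) *\<^sub>R w + (1 / \<beta>) *\<^sub>R g))\<^sup>2
      \<le> (\<tau> - 1) / \<tau> * (norm ((- \<tau>) *\<^sub>R w))\<^sup>2 + (1 - (\<tau> - 1) / \<tau>) * (norm ((\<tau> / \<beta>) *\<^sub>R g))\<^sup>2"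
    using norm_sq_convex_comb_le[of "(\<tau> - 1) / \<tau>" "(- \<tau>) *\<^sub>R w" "(\<tau> / \<beta>) *\<^sub>R g"] False by simp
  also have "\<dots> = \<tau> * (\<tau> - 1) * (norm w)\<^sup>2 + \<tau> / \<beta>\<^sup>2 * (norm g)\<^sup>2"
    using tau beta by (simp add: power_mult_distrib power_divide field_simps power2_eq_square)
  finally have "(\<tau> + theta \<tau>) * \<beta> * (norm ((1 - \<tau>) *\<^sub>R w + (1 / \<beta>) *\<^sub>R g))\<^sup>2
      \<le> \<tau> / d * \<beta> * (\<tau> * (\<tau> - 1) * (norm w)\<^sup>2 + \<tau> / \<beta>\<^sup>2 * (norm g)\<^sup>2)"
    unfolding sum using beta d tau by (intro mult_left_mono) auto
  also have "\<dots> = theta \<tau> * \<beta> * (norm w)\<^sup>2 + (\<tau>\<^sup>2 / d) / \<beta> * (norm g)\<^sup>2"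
    unfolding th using beta d by (simp add: field_simps power2_eq_square)
  finally have "?lhs \<le> (\<tau>\<^sup>2 / d) / \<beta> * (norm g)\<^sup>2" by simp
  also have "\<dots> \<le> ?K / \<beta> * (norm g)\<^sup>2"
    using beta unfolding d_def by (intro mult_right_mono divide_right_mono) auto
  finally show ?thesis .
qed

text \<open>The second entry of \<open>beta_bar\<close> is the larger root of
  \<open>\<beta>\<^sup>2 + lmin * \<beta> - 2 * K * lmax\<^sup>2\<close>, where \<open>K\<close> is
  the maximum in the second claim; above it this quadratic is nonnegative.\<close>

lemma beta_bar_less_imp:
  assumes gt: "beta_bar \<tau> lmax lmin < \<beta>" and "0 < \<tau>" and "0 < \<beta>" and "0 \<le> lmax"
  shows "lmax < \<beta>"
    and "max (1 / \<tau>) (\<tau>\<^sup>2 / (1 + \<tau> - \<tau>\<^sup>2)) / \<beta> * lmax\<^sup>2 \<le> (lmin + \<beta>) / 2"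
proof -
  have "1 \<le> max (1 / \<tau>) \<tau>" using \<open>0 < \<tau>\<close> by (cases "\<tau> \<le> 1") (auto simp: le_max_iff_disj)
  then have "lmax \<le> max (1 / \<tau>) \<tau> * lmax"
    using \<open>0 \<le> lmax\<close> by (metis mult_1 mult_right_mono)
  then show "lmax < \<beta>" using gt unfolding beta_bar_def by simp
  let ?K = "max (1 / \<tau>) (\<tau>\<^sup>2 / (1 + \<tau> - \<tau>\<^sup>2))"
  have "sqrt (lmin\<^sup>2 + ?K * 8 * lmax\<^sup>2) < 2 * \<beta> + lmin"
    using gt unfolding beta_bar_def by simp
  moreover have "0 \<le> ?K" using \<open>0 < \<tau>\<close> by (auto simp: le_max_iff_disj)
  ultimately have "lmin\<^sup>2 + ?K * 8 * lmax\<^sup>2 \<le> (2 * \<beta> + lmin)\<^sup>2"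
    by (intro sqrt_le_D) simp
  then have "?K * lmax\<^sup>2 \<le> (lmin + \<beta>) / 2 * \<beta>"
    by (simp add: power2_eq_square algebra_simps)
  then show "?K / \<beta> * lmax\<^sup>2 \<le> (lmin + \<beta>) / 2"
    using \<open>0 < \<beta>\<close> by (simp add: pos_divide_le_eq)
qed

section \<open>The smooth part of the augmented Lagrangian\<close>

text \<open>\<open>V\<close> stands for \<open>B L + C S\<close>. Splitting off this real-valued
  part keeps the calculus in \<open>Z\<close> away from extended reals.\<close>

definition smooth_part ::
  "('a::euclidean_space \<Rightarrow> 'a) \<Rightarrow> 'a \<Rightarrow> real \<Rightarrow> 'a \<Rightarrow> 'a \<Rightarrow> 'a \<Rightarrow> real" where
  "smooth_part A D \<beta> V \<Lambda> Z =
     1/2 * (norm (D - A Z))\<^sup>2 - \<Lambda> \<bullet> (V - Z) + \<beta>/2 * (norm (V - Z))\<^sup>2"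

lemma aug_lagrangian_smooth_part:
  "aug_lagrangian \<Psi> \<Phi> A B C D \<beta> L S Z \<Lambda> = \<Psi> L + \<Phi> S + ereal (smooth_part A D \<beta> (B L + C S) \<Lambda> Z)"
  unfolding aug_lagrangian_def smooth_part_def ..

text \<open>A quadratic equals its second-order Taylor expansion; the vector paired with
  \<open>H\<close> is the gradient in \<open>Z\<close>.\<close>

lemma smooth_part_add:
  assumes "linear A"
  shows "smooth_part A D \<beta> V \<Lambda> (Z + H) = smooth_part A D \<beta> V \<Lambda> Z
    + (\<Lambda> - adjoint A (D - A Z) - \<beta> *\<^sub>R (V - Z)) \<bullet> H + (1/2 * (norm (A H))\<^sup>2 + \<beta>/2 * (norm H)\<^sup>2)"
  unfolding smooth_part_def power2_norm_eq_inner
  by (simp add: linear_add[OF assms] adjoint_clauses[OF assms] inner_simps inner_commute field_simps)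

text \<open>Along the gradient \<open>g\<close> the linear coefficient is
  \<open>g \<bullet> g\<close>, which minimality forces to be zero.\<close>

lemma smooth_part_minimiser:
  assumes lin: "linear A" and min: "\<And>Y. smooth_part A D \<beta> V \<Lambda> Z \<le> smooth_part A D \<beta> V \<Lambda> Y"
  shows "\<Lambda> = adjoint A (D - A Z) + \<beta> *\<^sub>R (V - Z)"
proof -
  define g where "g = \<Lambda> - adjoint A (D - A Z) - \<beta> *\<^sub>R (V - Z)"
  have "0 \<le> (g \<bullet> g) * t + (1/2 * (norm (A g))\<^sup>2 + \<beta>/2 * (norm g)\<^sup>2) * t\<^sup>2" for t
    using min[of "Z + t *\<^sub>R g"] unfolding smooth_part_add[OF lin] g_def[symmetric]
    by (simp add: linear_scale[OF lin] power_mult_distrib algebra_simps)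
  then have "g \<bullet> g = 0" by (rule linear_coeff_eq_0_of_quadratic_nonneg)
  then have "g = 0" by simp
  then show ?thesis unfolding g_def by (simp add: algebra_simps)
qed

text \<open>Serves as the coercivity statement extracted from \<open>a3\<close>: once
  \<open>norm L + norm S\<close> is large, the sum exceeds \<open>c\<close>.\<close>

lemma bounded_sublevel_of_less_liminf:
  assumes "c < liminf_at_infinity \<Psi> \<Phi>"
  obtains R where "\<And>L S. \<Psi> L + \<Phi> S \<le> c \<Longrightarrow> norm L + norm S \<le> R"
proof -
  have "eventually (\<lambda>p. c < (case p of (L, S) \<Rightarrow> \<Psi> L + \<Phi> S))
      (filtercomap (\<lambda>(L, S). norm L + norm S) at_top)"
    using assms unfolding liminf_at_infinity_def by (rule less_LiminfD)
  then obtain R where "\<And>L S. norm L + norm S \<ge> R \<Longrightarrow> c < \<Psi> L + \<Phi> S"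
    unfolding eventually_filtercomap eventually_at_top_linorder by fastforce
  then show ?thesis using that by (meson linorder_not_less order_less_imp_le nle_le)
qed

section \<open>Descent and lower bound for the smooth part of the potential\<close>

lemma multiplier_after_dual_step:
  fixes A :: "'a::euclidean_space \<Rightarrow> 'a"
  assumes lin: "linear A"
    and min: "\<And>Y. smooth_part A D \<beta> V \<Lambda> Z \<le> smooth_part A D \<beta> V \<Lambda> Y"
    and step: "\<Lambda>' = \<Lambda> - (\<tau> * \<beta>) *\<^sub>R (V - Z)"
  shows "\<Lambda>' = adjoint A (D - A Z) + ((1 - \<tau>) * \<beta>) *\<^sub>R (V - Z)"
  unfolding step by (subst smooth_part_minimiser[OF lin min]) (simp add: algebra_simps)

text \<open>Primes mark the new iterate. On the right, \<open>V'\<close> with the old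
  \<open>Z\<close> is the state after the \<open>L\<close>- and \<open>S\<close>-steps, while the
  \<open>theta\<close> term still carries the old residual. The gain of the \<open>Z\<close>-step
  pays for the dual step.\<close>

lemma smooth_potential_decrease:
  fixes A :: "'a::euclidean_space \<Rightarrow> 'a"
  assumes lin: "linear A" and tau: "0 < \<tau>" "\<tau> < (1 + sqrt 5) / 2" and beta: "0 < \<beta>"
    and gt: "beta_bar \<tau> (eig_max (adjoint A \<circ> A)) (eig_min (adjoint A \<circ> A)) < \<beta>"
    and mult: "\<Lambda> = adjoint A (D - A Z) + ((1 - \<tau>) * \<beta>) *\<^sub>R (V - Z)"
    and min: "\<And>Y. smooth_part A D \<beta> V' \<Lambda> Z' \<le> smooth_part A D \<beta> V' \<Lambda> Y"
    and step: "\<Lambda>' = \<Lambda> - (\<tau> * \<beta>) *\<^sub>R (V' - Z')"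
  shows "smooth_part A D \<beta> V' \<Lambda>' Z' + theta \<tau> * \<beta> * (norm (V' - Z'))\<^sup>2
    \<le> smooth_part A D \<beta> V' \<Lambda> Z + theta \<tau> * \<beta> * (norm (V - Z))\<^sup>2"
proof -
  let ?lmax = "eig_max (adjoint A \<circ> A)" and ?lmin = "eig_min (adjoint A \<circ> A)"
  let ?K = "max (1 / \<tau>) (\<tau>\<^sup>2 / (1 + \<tau> - \<tau>\<^sup>2))"
  define W W' H g where "W = V - Z" and "W' = V' - Z'" and "H = Z - Z'"
    and "g = adjoint A (A (Z' - Z))"
  have opt: "\<Lambda> = adjoint A (D - A Z') + \<beta> *\<^sub>R W'"
    unfolding W'_def by (rule smooth_part_minimiser[OF lin min])
  \<comment> \<open>Two formulas for \<open>\<Lambda>\<close> are compared: \<open>mult\<close> from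
    the previous dual step and \<open>opt\<close> from stationarity at \<open>Z'\<close>.\<close>
  have "adjoint A (D - A Z) - adjoint A (D - A Z') = g"
    unfolding g_def
    by (simp add: linear_diff[OF lin] linear_diff[OF adjoint_linear[OF lin]])
  then have "\<beta> *\<^sub>R W' = ((1 - \<tau>) * \<beta>) *\<^sub>R W + g"
    using opt mult unfolding W_def by (simp add: algebra_simps)
  then have "(1 / \<beta>) *\<^sub>R (\<beta> *\<^sub>R W') = (1 / \<beta>) *\<^sub>R (((1 - \<tau>) * \<beta>) *\<^sub>R W + g)" by simp
  then have W': "W' = (1 - \<tau>) *\<^sub>R W + (1 / \<beta>) *\<^sub>R g"
    using beta by (simp add: scaleR_add_right)
  have "(\<tau> + theta \<tau>) * \<beta> * (norm W')\<^sup>2 - theta \<tau> * \<beta> * (norm W)\<^sup>2 \<le> ?K / \<beta> * (norm g)\<^sup>2"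
    unfolding W' by (rule residual_recursion_bound[OF tau beta])
  also have "\<dots> \<le> ?K / \<beta> * (?lmax\<^sup>2 * (norm H)\<^sup>2)"
  proof (rule mult_left_mono)
    show "(norm g)\<^sup>2 \<le> ?lmax\<^sup>2 * (norm H)\<^sup>2"
      unfolding g_def H_def using norm_gram_le_eig_max[OF lin] by (metis norm_minus_commute)
    show "0 \<le> ?K / \<beta>" using tau beta by (simp add: le_max_iff_disj)
  qed
  also have "\<dots> \<le> (?lmin + \<beta>) / 2 * (norm H)\<^sup>2"
    using beta_bar_less_imp(2)[OF gt tau(1) beta eig_max_gram_nonneg[OF lin]]
    by (metis mult.assoc mult_right_mono zero_le_power2)
  also have "\<dots> \<le> 1/2 * (norm (A H))\<^sup>2 + \<beta>/2 * (norm H)\<^sup>2"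
    using eig_min_le_norm_sq[OF lin, of H] by (simp add: algebra_simps)
  finally have dual: "(\<tau> + theta \<tau>) * \<beta> * (norm W')\<^sup>2 - theta \<tau> * \<beta> * (norm W)\<^sup>2
      \<le> 1/2 * (norm (A H))\<^sup>2 + \<beta>/2 * (norm H)\<^sup>2" .
  \<comment> \<open>Stationarity at \<open>Z'\<close> removes the linear term, so the gain of the
    \<open>Z\<close>-step is exactly the quadratic one.\<close>
  have "smooth_part A D \<beta> V' \<Lambda> Z
      = smooth_part A D \<beta> V' \<Lambda> Z' + (1/2 * (norm (A H))\<^sup>2 + \<beta>/2 * (norm H)\<^sup>2)"
    using smooth_part_add[OF lin, of D \<beta> V' \<Lambda> Z' H] opt unfolding H_def W'_def by simp
  moreover have "smooth_part A D \<beta> V' \<Lambda>' Z' = smooth_part A D \<beta> V' \<Lambda> Z' + \<tau> * \<beta> * (norm W')\<^sup>2"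
    unfolding smooth_part_def step W'_def[symmetric] power2_norm_eq_inner by (simp add: inner_simps)
  ultimately show ?thesis
    using dual unfolding W_def[symmetric] W'_def[symmetric] by (simp add: algebra_simps)
qed

text \<open>With \<open>mult\<close> inserted, the pairing with \<open>A W\<close> completes the
  square of the data term at the cost of \<open>1/2 * (norm (A W))\<^sup>2\<close>;
  \<open>theta \<tau> \<ge> 1 - \<tau>\<close> compensates the rest of the multiplier.\<close>

lemma smooth_potential_ge:
  fixes A :: "'a::euclidean_space \<Rightarrow> 'a"
  assumes lin: "linear A" and beta: "0 < \<beta>"
    and mult: "\<Lambda> = adjoint A (D - A Z) + ((1 - \<tau>) * \<beta>) *\<^sub>R (V - Z)"
  shows "(\<beta> - eig_max (adjoint A \<circ> A)) / 2 * (norm (V - Z))\<^sup>2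
    \<le> smooth_part A D \<beta> V \<Lambda> Z + theta \<tau> * \<beta> * (norm (V - Z))\<^sup>2"
proof -
  define W where "W = V - Z"
  have "smooth_part A D \<beta> V \<Lambda> Z
      = 1/2 * (norm (D - A Z - A W))\<^sup>2 - 1/2 * (norm (A W))\<^sup>2 + \<beta>/2 * (norm W)\<^sup>2
        - (1 - \<tau>) * \<beta> * (norm W)\<^sup>2"
    unfolding smooth_part_def W_def[symmetric] mult power2_norm_eq_inner
    by (simp add: adjoint_clauses[OF lin] inner_simps inner_commute field_simps)
  moreover have "(1 - \<tau>) * \<beta> * (norm W)\<^sup>2 \<le> theta \<tau> * \<beta> * (norm W)\<^sup>2"
    unfolding theta_def using beta by (intro mult_right_mono) auto
  moreover have "0 \<le> 1/2 * (norm (D - A Z - A W))\<^sup>2" by simp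
  moreover have "(\<beta> - eig_max (adjoint A \<circ> A)) / 2 * (norm W)\<^sup>2
      \<le> \<beta>/2 * (norm W)\<^sup>2 - 1/2 * (norm (A W))\<^sup>2"
    using norm_sq_le_eig_max[OF lin, of W] by (simp add: field_simps)
  ultimately show ?thesis unfolding W_def[symmetric] by linarith
qed

section \<open>Monotonicity of the potential and boundedness\<close>

text \<open>Finiteness allows the common extended-real summand to be cancelled; with an infinite
  summand, minimality in \<open>Z\<close> would carry no information.\<close>

lemma admm_Z_step:
  assumes admm: "admm_sequence \<Psi> \<Phi> A B C D \<tau> \<beta> L S Z \<Lambda>"
    and fin: "\<bar>\<Psi> (L (Suc k)) + \<Phi> (S (Suc k))\<bar> \<noteq> \<infinity>"
  shows "smooth_part A D \<beta> (B (L (Suc k)) + C (S (Suc k))) (\<Lambda> k) (Z (Suc k))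
    \<le> smooth_part A D \<beta> (B (L (Suc k)) + C (S (Suc k))) (\<Lambda> k) Y"
proof -
  obtain r where r: "\<Psi> (L (Suc k)) + \<Phi> (S (Suc k)) = ereal r" using fin by blast
  have "aug_lagrangian \<Psi> \<Phi> A B C D \<beta> (L (Suc k)) (S (Suc k)) (Z (Suc k)) (\<Lambda> k)
      \<le> aug_lagrangian \<Psi> \<Phi> A B C D \<beta> (L (Suc k)) (S (Suc k)) Y (\<Lambda> k)"
    using admm unfolding admm_sequence_def is_arg_min_linorder by blast
  then show ?thesis unfolding aug_lagrangian_smooth_part r by simp
qed

lemma admm_LS_step:
  assumes "admm_sequence \<Psi> \<Phi> A B C D \<tau> \<beta> L S Z \<Lambda>"
  shows "aug_lagrangian \<Psi> \<Phi> A B C D \<beta> (L (Suc k)) (S (Suc k)) (Z k) (\<Lambda> k)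
    \<le> aug_lagrangian \<Psi> \<Phi> A B C D \<beta> (L k) (S k) (Z k) (\<Lambda> k)"
proof (rule order_trans)
  show "aug_lagrangian \<Psi> \<Phi> A B C D \<beta> (L (Suc k)) (S (Suc k)) (Z k) (\<Lambda> k)
      \<le> aug_lagrangian \<Psi> \<Phi> A B C D \<beta> (L (Suc k)) (S k) (Z k) (\<Lambda> k)"
    using assms unfolding admm_sequence_def is_arg_min_linorder by blast
  show "aug_lagrangian \<Psi> \<Phi> A B C D \<beta> (L (Suc k)) (S k) (Z k) (\<Lambda> k)
      \<le> aug_lagrangian \<Psi> \<Phi> A B C D \<beta> (L k) (S k) (Z k) (\<Lambda> k)"
    using assms unfolding admm_sequence_def is_arg_min_linorder by blast
qed

lemma admm_multiplier:
  fixes A :: "'a::euclidean_space \<Rightarrow> 'a"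
  assumes "linear A" and admm: "admm_sequence \<Psi> \<Phi> A B C D \<tau> \<beta> L S Z \<Lambda>"
    and "\<bar>\<Psi> (L (Suc k)) + \<Phi> (S (Suc k))\<bar> \<noteq> \<infinity>"
  shows "\<Lambda> (Suc k) = adjoint A (D - A (Z (Suc k)))
    + ((1 - \<tau>) * \<beta>) *\<^sub>R (B (L (Suc k)) + C (S (Suc k)) - Z (Suc k))"
proof (rule multiplier_after_dual_step[OF \<open>linear A\<close> admm_Z_step[OF admm assms(3)]])
  show "\<Lambda> (Suc k) = \<Lambda> k - (\<tau> * \<beta>) *\<^sub>R (B (L (Suc k)) + C (S (Suc k)) - Z (Suc k))"
    using admm unfolding admm_sequence_def by blast
qed

lemma potential_smooth_part:
  "potential \<Psi> \<Phi> A B C D \<tau> \<beta> L S Z \<Lambda> = \<Psi> L + \<Phi> S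
    + ereal (smooth_part A D \<beta> (B L + C S) \<Lambda> Z + theta \<tau> * \<beta> * (norm (B L + C S - Z))\<^sup>2)"
  unfolding potential_def aug_lagrangian_smooth_part by (simp add: add.assoc)

lemma nonneg_finite_of_add_ereal:
  fixes a :: ereal
  assumes "0 \<le> a" and "a + ereal r < \<infinity>"
  shows "\<bar>a\<bar> \<noteq> \<infinity>"
  using assms by (cases a) auto

text \<open>The index starts at \<open>Suc k\<close> because \<open>\<Lambda> 0\<close> is
  arbitrary: the multiplier formula needs a completed dual step.\<close>

lemma admm_potential_step:
  fixes A :: "'a::euclidean_space \<Rightarrow> 'a"
  assumes nonneg: "\<And>X. 0 \<le> \<Psi> X" "\<And>X. 0 \<le> \<Phi> X"
    and lin: "linear A" and tau: "0 < \<tau>" "\<tau> < (1 + sqrt 5) / 2" and beta: "0 < \<beta>"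
    and gt: "beta_bar \<tau> (eig_max (adjoint A \<circ> A)) (eig_min (adjoint A \<circ> A)) < \<beta>"
    and admm: "admm_sequence \<Psi> \<Phi> A B C D \<tau> \<beta> L S Z \<Lambda>"
    and fin: "potential \<Psi> \<Phi> A B C D \<tau> \<beta> (L (Suc k)) (S (Suc k)) (Z (Suc k)) (\<Lambda> (Suc k)) < \<infinity>"
  shows "potential \<Psi> \<Phi> A B C D \<tau> \<beta> (L (Suc (Suc k))) (S (Suc (Suc k))) (Z (Suc (Suc k))) (\<Lambda> (Suc (Suc k)))
    \<le> potential \<Psi> \<Phi> A B C D \<tau> \<beta> (L (Suc k)) (S (Suc k)) (Z (Suc k)) (\<Lambda> (Suc k))"
proof -
  let ?f = "\<lambda>k. \<Psi> (L k) + \<Phi> (S k)" and ?V = "\<lambda>k. B (L k) + C (S k)" and ?s = "smooth_part A D \<beta>"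
  have f0: "0 \<le> ?f k" for k using nonneg by simp
  have f1: "\<bar>?f (Suc k)\<bar> \<noteq> \<infinity>"
    by (rule nonneg_finite_of_add_ereal[OF f0 fin[unfolded potential_smooth_part]])
  \<comment> \<open>The \<open>L\<close>- and \<open>S\<close>-steps do not raise the Lagrangian, so
    finiteness passes to the new iterate, as \<open>admm_Z_step\<close> requires.\<close>
  have LS: "?f (Suc (Suc k)) + ereal (?s (?V (Suc (Suc k))) (\<Lambda> (Suc k)) (Z (Suc k)))
      \<le> ?f (Suc k) + ereal (?s (?V (Suc k)) (\<Lambda> (Suc k)) (Z (Suc k)))"
    using admm_LS_step[OF admm, of "Suc k"] unfolding aug_lagrangian_smooth_part .
  also have "\<dots> < \<infinity>" using f1 by auto
  finally have f2: "\<bar>?f (Suc (Suc k))\<bar> \<noteq> \<infinity>"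
    by (rule nonneg_finite_of_add_ereal[OF f0])
  have dual: "\<Lambda> (Suc (Suc k)) = \<Lambda> (Suc k) - (\<tau> * \<beta>) *\<^sub>R (?V (Suc (Suc k)) - Z (Suc (Suc k)))"
    using admm unfolding admm_sequence_def by blast
  have "?s (?V (Suc (Suc k))) (\<Lambda> (Suc (Suc k))) (Z (Suc (Suc k)))
        + theta \<tau> * \<beta> * (norm (?V (Suc (Suc k)) - Z (Suc (Suc k))))\<^sup>2
      \<le> ?s (?V (Suc (Suc k))) (\<Lambda> (Suc k)) (Z (Suc k))
        + theta \<tau> * \<beta> * (norm (?V (Suc k) - Z (Suc k)))\<^sup>2"
    by (rule smooth_potential_decrease[OF lin tau beta gt admm_multiplier[OF lin admm f1]
          admm_Z_step[OF admm f2] dual])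
  then show ?thesis
    unfolding potential_smooth_part using f1 f2 LS
    by (cases "?f (Suc k)"; cases "?f (Suc (Suc k))") auto
qed

lemma admm_potential_le_initial:
  fixes A :: "'a::euclidean_space \<Rightarrow> 'a"
  assumes nonneg: "\<And>X. 0 \<le> \<Psi> X" "\<And>X. 0 \<le> \<Phi> X"
    and lin: "linear A" and tau: "0 < \<tau>" "\<tau> < (1 + sqrt 5) / 2" and beta: "0 < \<beta>"
    and gt: "beta_bar \<tau> (eig_max (adjoint A \<circ> A)) (eig_min (adjoint A \<circ> A)) < \<beta>"
    and admm: "admm_sequence \<Psi> \<Phi> A B C D \<tau> \<beta> L S Z \<Lambda>"
    and fin: "potential \<Psi> \<Phi> A B C D \<tau> \<beta> (L 1) (S 1) (Z 1) (\<Lambda> 1) < \<infinity>"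
  shows "potential \<Psi> \<Phi> A B C D \<tau> \<beta> (L (Suc k)) (S (Suc k)) (Z (Suc k)) (\<Lambda> (Suc k))
    \<le> potential \<Psi> \<Phi> A B C D \<tau> \<beta> (L 1) (S 1) (Z 1) (\<Lambda> 1)"
proof (induction k)
  case (Suc k)
  \<comment> \<open>The induction hypothesis also supplies the finiteness assumed by the one-step
    estimate.\<close>
  from admm_potential_step[OF nonneg lin tau beta gt admm le_less_trans[OF Suc.IH fin]] Suc.IH
  show ?case by (rule order_trans)
qed simp

section \<open>Boundedness of the iterates\<close>

lemma bounded_range_linear_image:
  fixes f :: "'a::euclidean_space \<Rightarrow> 'b::euclidean_space"
  assumes "bounded (range x)" and "linear f"
  shows "bounded (range (\<lambda>k. f (x k)))"
  using bounded_linear_image[OF assms(1)] assms(2)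
  by (simp add: linear_conv_bounded_linear image_image)

theorem proposition4p2:
  fixes \<Psi> \<Phi> :: "real^'n^'m \<Rightarrow> ereal"
    and A B C :: "real^'n^'m \<Rightarrow> real^'n^'m"
    and D :: "real^'n^'m"
    and \<tau> \<beta> :: real
    and L S Z \<Lambda> :: "nat \<Rightarrow> real^'n^'m"
  assumes "\<And>X. 0 \<le> \<Psi> X" and "proper_fun \<Psi>" and "lower_semicontinuous \<Psi>" and "ereal_convex \<Psi>"
    and "\<And>X. 0 \<le> \<Phi> X" and "proper_fun \<Phi>" and "lower_semicontinuous \<Phi>"
    and "linear A" and "linear B" and "linear C" and "inj B" and "inj C"
    and "0 < \<tau>" and "\<tau> < (1 + sqrt 5) / 2"
    and "0 < \<beta>"
    and "\<beta> > beta_bar \<tau> (eig_max (adjoint A \<circ> A)) (eig_min (adjoint A \<circ> A))"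
    and "admm_sequence \<Psi> \<Phi> A B C D \<tau> \<beta> L S Z \<Lambda>"
    and a1: "\<exists>\<sigma>>0. loewner_ge (adjoint B \<circ> B) (\<lambda>X. \<sigma> *\<^sub>R X)"
            "\<exists>\<sigma>'>0. loewner_ge (adjoint C \<circ> C) (\<lambda>X. \<sigma>' *\<^sub>R X)"
    and a3: "potential \<Psi> \<Phi> A B C D \<tau> \<beta> (L 1) (S 1) (Z 1) (\<Lambda> 1) < liminf_at_infinity \<Psi> \<Phi>"
  shows "bounded ((\<lambda>k. (L k, S k, Z k, \<Lambda> k)) ` {1..})"
proof -
  note nonneg = assms(1,5) and lin = \<open>linear A\<close> and admm = assms(17)
  let ?P = "\<lambda>k. potential \<Psi> \<Phi> A B C D \<tau> \<beta> (L k) (S k) (Z k) (\<Lambda> k)"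
  define f where "f k = \<Psi> (L (Suc k)) + \<Phi> (S (Suc k))" for k
  define W where "W k = B (L (Suc k)) + C (S (Suc k)) - Z (Suc k)" for k
  define c where "c = (\<beta> - eig_max (adjoint A \<circ> A)) / 2"
  have f0: "0 \<le> f k" for k using nonneg f_def by simp
  \<comment> \<open>The limit inferior may itself be infinite; the strict inequality still makes the
    potential less than \<open>\<infinity>\<close>.\<close>
  have P1: "?P 1 < \<infinity>" using a3 by (rule less_le_trans) simp
  have P: "?P (Suc k) \<le> ?P 1" for k
    by (rule admm_potential_le_initial[OF nonneg lin assms(13-16) admm P1])
  have fin: "\<bar>f k\<bar> \<noteq> \<infinity>" for k
    using le_less_trans[OF P P1] unfolding potential_smooth_part f_def[symmetric]
    by (rule nonneg_finite_of_add_ereal[OF f0])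
  have mult: "\<Lambda> (Suc k) = adjoint A (D - A (Z (Suc k))) + ((1 - \<tau>) * \<beta>) *\<^sub>R W k" for k
    unfolding W_def by (rule admm_multiplier[OF lin admm fin[unfolded f_def]])
  have "0 < c"
    unfolding c_def using beta_bar_less_imp(1)[OF assms(16,13,15) eig_max_gram_nonneg[OF lin]] by simp
  have le: "f k + ereal (c * (norm (W k))\<^sup>2) \<le> ?P 1" for k
  proof -
    have "f k + ereal (c * (norm (W k))\<^sup>2) \<le> ?P (Suc k)"
      unfolding potential_smooth_part f_def c_def W_def
      using smooth_potential_ge[OF lin \<open>0 < \<beta>\<close> mult[unfolded W_def]]
      by (intro add_left_mono) simp
    then show ?thesis using P by (rule order_trans)
  qed

  \<comment> \<open>Dropping the nonnegative residual term places all pairs \<open>(L, S)\<close> in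
    one sublevel set.\<close>
  have "f k \<le> ?P 1" for k
  proof -
    have "f k \<le> f k + ereal (c * (norm (W k))\<^sup>2)" using \<open>0 < c\<close> by (cases "f k") auto
    then show ?thesis using le by (rule order_trans)
  qed
  then obtain R where R: "\<And>k. norm (L (Suc k)) + norm (S (Suc k)) \<le> R"
    using bounded_sublevel_of_less_liminf[OF a3] unfolding f_def by metis
  then have bdL: "bounded (range (\<lambda>k. L (Suc k)))" and bdS: "bounded (range (\<lambda>k. S (Suc k)))"
    unfolding bounded_iff by (smt (verit) norm_ge_zero rangeE)+

  \<comment> \<open>\<open>P1\<close> excludes \<open>\<infinity>\<close>, and \<open>le\<close> at
    index 0 gives a real lower bound.\<close>
  obtain p where p: "?P 1 = ereal p"
    using P1 le[of 0] f0[of 0] fin[of 0] by (cases "?P 1"; cases "f 0") auto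
  have "norm (W k) \<le> sqrt (p / c)" for k
  proof -
    have "c * (norm (W k))\<^sup>2 \<le> p"
      using le[of k] f0[of k] fin[of k] unfolding p by (cases "f k") auto
    then show ?thesis using \<open>0 < c\<close> by (intro real_le_rsqrt) (simp add: field_simps)
  qed
  then have bdW: "bounded (range W)" unfolding bounded_iff by blast

  \<comment> \<open>\<open>Z\<close> is recovered from the bounded residual \<open>W\<close> and the
    images of \<open>L\<close> and \<open>S\<close>.\<close>
  have "bounded (range (\<lambda>k. B (L (Suc k)) + C (S (Suc k)) - W k))"
    using bounded_range_linear_image[OF bdL \<open>linear B\<close>] bounded_range_linear_image[OF bdS \<open>linear C\<close>] bdW
    by (intro bounded_minus_comp bounded_plus_comp)
  then have bdZ: "bounded (range (\<lambda>k. Z (Suc k)))" unfolding W_def by simp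
  have "bounded (range (\<lambda>k. D - A (Z (Suc k))))"
    using bounded_range_linear_image[OF bdZ lin] by (intro bounded_minus_comp) simp_all
  then have "bounded (range (\<lambda>k. adjoint A (D - A (Z (Suc k))) + ((1 - \<tau>) * \<beta>) *\<^sub>R W k))"
    by (intro bounded_plus_comp bounded_range_linear_image[OF _ adjoint_linear[OF lin]]
        bounded_range_linear_image[OF bdW] linear_scaleR)
  then have bd\<Lambda>: "bounded (range (\<lambda>k. \<Lambda> (Suc k)))" by (simp flip: mult)

  \<comment> \<open>The indices from 1 on are exactly the successors, for which the bounds were
    shown.\<close>
  have "(\<lambda>k. (L k, S k, Z k, \<Lambda> k)) ` {1..} \<subseteq> range (\<lambda>k. L (Suc k))
      \<times> range (\<lambda>k. S (Suc k)) \<times> range (\<lambda>k. Z (Suc k)) \<times> range (\<lambda>k. \<Lambda> (Suc k))"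
  proof (rule image_subsetI)
    fix k :: nat
    assume "k \<in> {1..}"
    then obtain j where "k = Suc j" by (cases k) auto
    then show "(L k, S k, Z k, \<Lambda> k) \<in> range (\<lambda>k. L (Suc k))
      \<times> range (\<lambda>k. S (Suc k)) \<times> range (\<lambda>k. Z (Suc k)) \<times> range (\<lambda>k. \<Lambda> (Suc k))" by blast
  qed
  then show ?thesis by (rule bounded_subset[rotated]) (intro bounded_Times bdL bdS bdZ bd\<Lambda>)
qed

end
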